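(* Let $d\ge2$ and $m\ge d-1$ be integers, $p_0,\dots,p_m>0$ with $\sum_j p_j=1$, and let $\mu$ be the self-similar probability measure satisfying $\mu=\sum_{j=0}^m p_j\,\mu\circ S_j^{-1}$ with $S_j(x)=\frac1d x+\frac{j}{md}(d-1)$. For $i=0,\dots,d-1$ let $P_i=\sum_{0\le j\le m,\ j\equiv i\bmod d}p_j$ and $P_{\min}=\min_i P_i$. Let $D=\{\dim_{loc}\mu(x):x\in[0,1],\text{ the local dimension at }x\text{ exists}\}$. (1) If $p_0<P_{\min}$, then $\dim_{loc}\mu(0)$ is an isolated point of $D$. (2) If $m\ge d$ and $p_0<p_j$ for all $j\ne0,m$, then $\dim_{loc}\mu(0)$ is an isolated point of $D$. Similarly, if $p_m<P_{\min}$, or if $m\ge d$ and $p_m<p_j$ for all $j\neq 0,m$, then $\dim_{loc}\mu(1)$ is an isolated point of $D$.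
   Context: The support of $\mu$ is $[0,1]$. $\dim_{loc}\mu(x)=\lim_{r\to0^+}\frac{\log\mu([x-r,x+r])}{\log r}$ when the limit exists. *)

theory Defs
  imports "HOL-Probability.Probability"
begin

definition sim_map :: "nat \<Rightarrow> nat \<Rightarrow> nat \<Rightarrow> real \<Rightarrow> real" where
  "sim_map d m j x = x / real d + real j / (real m * real d) * (real d - 1)"

text \<open>
  The probabilities \<open>p\<^sub>0, \<dots>, p\<^sub>m\<close> are the values \<open>p j\<close> with \<open>j \<le> m\<close>; the values of
  \<open>p\<close> beyond \<open>m\<close> play no role.
\<close>

definition self_similar_measure :: "nat \<Rightarrow> nat \<Rightarrow> (nat \<Rightarrow> real) \<Rightarrow> real measure \<Rightarrow> bool" where
  "self_similar_measure d m p \<mu> \<longleftrightarrow>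
     prob_space \<mu> \<and> sets \<mu> = sets borel \<and>
     (\<forall>A\<in>sets borel. measure \<mu> A = (\<Sum>j\<le>m. p j * measure \<mu> (sim_map d m j -` A)))"

definition residue_prob :: "nat \<Rightarrow> nat \<Rightarrow> (nat \<Rightarrow> real) \<Rightarrow> nat \<Rightarrow> real" where
  "residue_prob d m p i = (\<Sum>j\<in>{j. j \<le> m \<and> j mod d = i mod d}. p j)"

definition residue_prob_min :: "nat \<Rightarrow> nat \<Rightarrow> (nat \<Rightarrow> real) \<Rightarrow> real" where
  "residue_prob_min d m p = Min (residue_prob d m p ` {..<d})"

definition has_local_dim :: "real measure \<Rightarrow> real \<Rightarrow> real \<Rightarrow> bool" where
  "has_local_dim \<mu> x L \<longleftrightarrow>
     ((\<lambda>r. ln (measure \<mu> {x - r..x + r}) / ln r) \<longlongrightarrow> L) (at_right 0)"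

definition local_dim_exists :: "real measure \<Rightarrow> real \<Rightarrow> bool" where
  "local_dim_exists \<mu> x \<longleftrightarrow> (\<exists>L. has_local_dim \<mu> x L)"

definition local_dim :: "real measure \<Rightarrow> real \<Rightarrow> real" where
  "local_dim \<mu> x = Lim (at_right 0) (\<lambda>r. ln (measure \<mu> {x - r..x + r}) / ln r)"

text \<open>
  Requiring finite limits loses nothing for the self-similar measures above: their support is
  \<open>{0..1}\<close> and the measure of an interval centred in \<open>{0..1}\<close> is bounded below by a constant times a power of its
  length, so an infinite local dimension does not occur.
\<close>

definition local_dims :: "real measure \<Rightarrow> real set" where
  "local_dims \<mu> = {local_dim \<mu> x | x. x \<in> {0..1} \<and> local_dim_exists \<mu> x}"

text \<open>
  Off its domain \<open>local_dim\<close> is an unspecified real, so existence of the local dimension at \<open>x\<close> is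
  part of the following notion.
\<close>

definition local_dim_isolated_at :: "real measure \<Rightarrow> real \<Rightarrow> bool" where
  "local_dim_isolated_at \<mu> x \<longleftrightarrow>
     local_dim_exists \<mu> x \<and> local_dim \<mu> x isolated_in local_dims \<mu>"

end

theory Submission
  imports Defs
begin

text \<open>
  Put \<open>s = (d - 1) / m\<close>. The \<open>n\<close>-fold compositions of the \<open>S\<^sub>j\<close> are the maps
  \<open>x \<mapsto> (x + s k) / d\<^sup>n\<close> with \<open>k = \<Sum> a\<^sub>i d\<^sup>n\<^sup>-\<^sup>i\<close> for digits \<open>a\<^sub>i \<in> {0..m}\<close>. For \<open>x\<close> in the open unit interval
  let \<open>K\<^sub>n = \<lfloor>d\<^sup>n x / s\<rfloor>\<close>. Every \<open>k'\<close> in the window \<open>[K\<^sub>n\<^sub>+\<^sub>1 - m, K\<^sub>n\<^sub>+\<^sub>1]\<close> has all its possible predecessors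
  \<open>(k' - a) / d\<close> in the window \<open>[K\<^sub>n - m, K\<^sub>n]\<close>, so the smallest weight in the window is multiplied by at least
  \<open>P\<^sub>m\<^sub>i\<^sub>n\<close> when passing from \<open>n\<close> to \<open>n + 1\<close>. Hence every local dimension at an interior point is at most
  \<open>- ln P\<^sub>m\<^sub>i\<^sub>n / ln d\<close>, while the local dimensions at 0 and 1 are \<open>- ln p\<^sub>0 / ln d\<close> and
  \<open>- ln p\<^sub>m / ln d\<close>. The hypotheses of (2) imply those of (1).
\<close>

section \<open>Uniqueness of the local dimension and residue-class sums of the probabilities\<close>

lemma local_dim_eq:
  assumes "has_local_dim \<mu> x L"
  shows "local_dim \<mu> x = L"
  using assms unfolding has_local_dim_def local_dim_def
  by (intro tendsto_Lim) auto

lemma residue_prob_geI: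
  assumes "\<And>j. j \<le> m \<Longrightarrow> 0 < p j" and "j \<le> m" and "j mod d = i mod d"
  shows "p j \<le> residue_prob d m p i"
proof -
  have "sum p {j} \<le> residue_prob d m p i"
    unfolding residue_prob_def using assms by (intro sum_mono2) (auto intro: less_imp_le)
  then show ?thesis by simp
qed

lemma residue_prob_gtI:
  assumes "\<And>j. j \<le> m \<Longrightarrow> 0 < p j" and "j \<le> m" and "k \<le> m" and "j \<noteq> k"
    and "j mod d = i mod d" and "k mod d = i mod d"
  shows "p j < residue_prob d m p i"
proof -
  have "sum p {j, k} \<le> residue_prob d m p i"
    unfolding residue_prob_def using assms by (intro sum_mono2) (auto intro: less_imp_le)
  then show ?thesis using assms(1)[OF assms(3)] assms(4) by simp
qed

lemma less_residue_prob_minI: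
  assumes "d > 0" and "\<And>i. i < d \<Longrightarrow> c < residue_prob d m p i"
  shows "c < residue_prob_min d m p"
  unfolding residue_prob_min_def using assms by (subst Min_gr_iff) auto

lemma residue_prob_min_le:
  assumes "d > 0"
  shows "residue_prob_min d m p \<le> residue_prob d m p i"
proof -
  have "residue_prob d m p i = residue_prob d m p (i mod d)"
    by (simp add: residue_prob_def)
  then show ?thesis
    unfolding residue_prob_min_def using assms by (auto intro!: Min_le)
qed

text \<open>A residue \<open>i\<close> with \<open>0 < i < d\<close> is itself an index different
  from 0 and \<open>m\<close>, because \<open>d \<le> m\<close>, so \<open>p i\<close> alone exceeds
  \<open>p 0\<close>. The class of 0 also contains \<open>d\<close>, so its sum exceeds
  \<open>p 0\<close> by at least \<open>p d > 0\<close>.\<close>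

lemma first_less_residue_prob_min:
  assumes "d \<ge> 2" and "m \<ge> d" and pos: "\<And>j. j \<le> m \<Longrightarrow> 0 < p j"
    and less: "\<And>j. j \<le> m \<Longrightarrow> j \<noteq> 0 \<Longrightarrow> j \<noteq> m \<Longrightarrow> p 0 < p j"
  shows "p 0 < residue_prob_min d m p"
proof (rule less_residue_prob_minI)
  show "p 0 < residue_prob d m p i" if "i < d" for i
  proof (cases "i = 0")
    case True
    show ?thesis
      by (rule residue_prob_gtI[where k = d]) (use True \<open>2 \<le> d\<close> \<open>d \<le> m\<close> pos in auto)
  next
    case False
    have "p 0 < p i" using False that \<open>d \<le> m\<close> by (intro less) auto
    also have "p i \<le> residue_prob d m p i"
      by (rule residue_prob_geI) (use that \<open>d \<le> m\<close> pos in auto)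
    finally show ?thesis .
  qed
qed (use \<open>2 \<le> d\<close> in simp)

text \<open>The class of \<open>m\<close> also contains \<open>m - d\<close>, which makes its sum
  strictly larger than \<open>p m\<close>. Every other class contains an index different from 0 and
  \<open>m\<close>.\<close>

lemma last_less_residue_prob_min:
  assumes "d \<ge> 2" and "m \<ge> d" and pos: "\<And>j. j \<le> m \<Longrightarrow> 0 < p j"
    and less: "\<And>j. j \<le> m \<Longrightarrow> j \<noteq> 0 \<Longrightarrow> j \<noteq> m \<Longrightarrow> p m < p j"
  shows "p m < residue_prob_min d m p"
proof (rule less_residue_prob_minI)
  show "p m < residue_prob d m p i" if "i < d" for i
  proof (cases "i = m mod d")
    case True
    show ?thesis
      by (rule residue_prob_gtI[where k = "m - d"]) (use True \<open>2 \<le> d\<close> \<open>d \<le> m\<close> pos in \<open>auto simp: le_mod_geq\<close>)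
  next
    case False
    \<comment> \<open>For residue 0 the representative has to be \<open>d\<close>, as the hypothesis
      says nothing about index 0. In that case \<open>d \<noteq> m\<close>, since \<open>m\<close>
      is not in the class.\<close>
    define j where "j = (if i = 0 then d else i)"
    have j: "j \<le> m" "j \<noteq> 0" "j \<noteq> m" "j mod d = i mod d"
      using False that \<open>2 \<le> d\<close> \<open>d \<le> m\<close> by (auto simp: j_def)
    have "p m < p j" using j by (intro less) auto
    also have "p j \<le> residue_prob d m p i"
      by (rule residue_prob_geI) (use j pos in auto)
    finally show ?thesis .
  qed
qed (use \<open>2 \<le> d\<close> in simp)

text \<open>Gives the limit of ln(c P^n) / ln(R / d^n), which bounds the local dimension at interior
  points. Dividing numerator and denominator by n reduces it to limits of 1/n.\<close>

lemma tendsto_ratio_linear: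
  fixes a b e f :: real
  assumes "f > 0"
  shows "(\<lambda>n. (a + real n * b) / (e - real n * f)) \<longlonglongrightarrow> - b / f"
proof -
  have inv: "(\<lambda>n. inverse (real n)) \<longlonglongrightarrow> 0"
    by (rule lim_inverse_n)
  have "(\<lambda>n. (a * inverse (real n) + b) / (e * inverse (real n) - f)) \<longlonglongrightarrow>
      (a * 0 + b) / (e * 0 - f)"
    using assms by (intro tendsto_intros inv) auto
  moreover have "\<forall>\<^sub>F n in sequentially.
      (a * inverse (real n) + b) / (e * inverse (real n) - f) =
      (a + real n * b) / (e - real n * f)"
    using eventually_gt_at_top[of 0]
  proof eventually_elim
    case (elim n)
    have "(a + real n * b) / (e - real n * f) =
        (real n * (a * inverse (real n) + b)) / (real n * (e * inverse (real n) - f))"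
      using elim by (simp add: algebra_simps)
    then show ?case using elim by simp
  qed
  ultimately show ?thesis by (auto dest: Lim_transform_eventually)
qed

section \<open>The self-similar measure as a real distribution, and its vanishing on the negative
  half-line\<close>

locale self_similar =
  fixes d m :: nat and p :: "nat \<Rightarrow> real" and \<mu> :: "real measure"
  assumes d_ge_2: "d \<ge> 2" and m_ge: "m \<ge> d - 1"
    and p_pos: "\<And>j. j \<le> m \<Longrightarrow> p j > 0"
    and p_sum: "(\<Sum>j\<le>m. p j) = 1"
    and self_similar: "self_similar_measure d m p \<mu>"
begin

sublocale real_distribution \<mu>
proof -
  have *: "prob_space \<mu>" "sets \<mu> = sets borel"
    using self_similar by (auto simp: self_similar_measure_def)
  interpret prob_space \<mu> by fact
  show "real_distribution \<mu>"
    by unfold_locales (use * sets_eq_imp_space_eq[of \<mu> borel] in auto)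
qed

lemma m_pos: "m > 0"
  using d_ge_2 m_ge by simp

lemma measure_sim_map:
  "A \<in> sets borel \<Longrightarrow> measure \<mu> A = (\<Sum>j\<le>m. p j * measure \<mu> (sim_map d m j -` A))"
  using self_similar by (simp add: self_similar_measure_def)

lemma sim_map_measurable: "sim_map d m j \<in> borel_measurable borel"
  unfolding sim_map_def by measurable

text \<open>Tightness, read off from the limits of the cdf. Pulled back through the similarities,
  this one interval yields all later positive lower bounds.\<close>

lemma measure_Icc_pos: "\<exists>R>0. measure \<mu> {-R..R} > 0"
proof -
  have "((\<lambda>x. cdf \<mu> x - cdf \<mu> (- x)) \<longlongrightarrow> 1 - 0) at_top"
    by (intro tendsto_diff cdf_lim_at_top_prob filterlim_compose[OF cdf_lim_at_bot]
        filterlim_uminus_at_bot_at_top)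
  then have "\<forall>\<^sub>F x in at_top. cdf \<mu> x - cdf \<mu> (- x) > 0"
    by (rule order_tendstoD) simp
  then have "\<forall>\<^sub>F x in at_top. x > 0 \<and> cdf \<mu> x - cdf \<mu> (- x) > 0"
    using eventually_gt_at_top[of 0] by eventually_elim auto
  then obtain R where R: "R > 0" "cdf \<mu> R - cdf \<mu> (- R) > 0"
    unfolding eventually_at_top_linorder by blast
  have "0 < measure \<mu> {-R<..R}" using R cdf_diff_eq[of "-R" R] by simp
  also have "\<dots> \<le> measure \<mu> {-R..R}"
    by (intro finite_measure_mono) auto
  finally show ?thesis using R by blast
qed

text \<open>Since S_j(x) \<ge> x/d, the inequality S_j(x) \<le> -t forces x \<le> -dt. Averaging
  over j, the cdf F satisfies F(-t) \<le> F(-dt), and iteration gives F(-t) \<le> F(-d^n t), which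
  tends to 0. The left limit of F at 0 then gives the mass of the open half-line.\<close>

lemma measure_negative: "measure \<mu> {..<0} = 0"
proof -
  have step: "cdf \<mu> (- t) \<le> cdf \<mu> (- (d * t))" for t :: real
  proof -
    have "cdf \<mu> (- t) = (\<Sum>j\<le>m. p j * measure \<mu> (sim_map d m j -` {..-t}))"
      unfolding cdf_def by (rule measure_sim_map) auto
    also have "\<dots> \<le> (\<Sum>j\<le>m. p j * cdf \<mu> (- (d * t)))"
      unfolding cdf_def
    proof (intro sum_mono mult_left_mono finite_measure_mono)
      fix j assume "j \<in> {..m}"
      have "0 \<le> real j / (real m * real d) * (real d - 1)"
        using d_ge_2 by auto
      then have "x / real d \<le> sim_map d m j x" for x by (simp add: sim_map_def)
      then have "x / real d \<le> - t" if "sim_map d m j x \<le> - t" for x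
        using that order_trans by blast
      then show "sim_map d m j -` {..- t} \<subseteq> {..- (d * t)}"
        using d_ge_2 by (auto simp: field_simps)
    qed (use p_pos in \<open>auto intro: less_imp_le\<close>)
    also have "\<dots> = cdf \<mu> (- (d * t))"
      using p_sum by (simp flip: sum_distrib_right)
    finally show ?thesis .
  qed
  have cdf0: "cdf \<mu> (- t) = 0" if "t > 0" for t :: real
  proof -
    have iter: "cdf \<mu> (- t) \<le> cdf \<mu> (- (real d ^ n * t))" for n
    proof (induction n)
      case (Suc n)
      show ?case using Suc step[of "real d ^ n * t"] by (simp add: mult_ac)
    qed simp
    have "filterlim (\<lambda>n. real d ^ n) at_infinity sequentially"
      using d_ge_2 by (intro filterlim_realpow_sequentially_gt1) auto
    then have "filterlim (\<lambda>n. real d ^ n) at_top sequentially"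
      using d_ge_2 by (intro filterlim_at_infinity_imp_filterlim_at_top) auto
    then have "filterlim (\<lambda>n. - (real d ^ n * t)) at_bot sequentially"
      using filterlim_at_top_mult_tendsto_pos[OF tendsto_const that]
      by (simp flip: filterlim_uminus_at_top)
    then have "(\<lambda>n. cdf \<mu> (- (real d ^ n * t))) \<longlonglongrightarrow> 0"
      by (rule filterlim_compose[OF cdf_lim_at_bot])
    then have "cdf \<mu> (- t) \<le> 0"
      using iter by (intro LIMSEQ_le_const) auto
    then show ?thesis using cdf_nonneg[of "-t"] by simp
  qed
  have "(cdf \<mu> \<longlongrightarrow> measure \<mu> {..<0}) (at_left 0)" by (rule cdf_at_left)
  moreover have "\<forall>\<^sub>F x in at_left 0. cdf \<mu> x = 0"
    using cdf0[of "- x" for x] by (auto simp: eventually_at_left_field intro!: exI[of _ "-1"])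
  ultimately have "((\<lambda>_. 0) \<longlongrightarrow> measure \<mu> {..<0}) (at_left (0::real))"
    by (rule Lim_transform_eventually)
  then show ?thesis
    by (simp add: tendsto_const_iff)
qed

section \<open>The local dimension at 0\<close>

lemma measure_near_0_ge: "p 0 * measure \<mu> {-(real d * r)..real d * r} \<le> measure \<mu> {-r..r}"
proof -
  have "sim_map d m 0 -` {-r..r} = {-(real d * r)..real d * r}"
    using d_ge_2 by (auto simp: sim_map_def field_simps)
  then have "p 0 * measure \<mu> {-(real d * r)..real d * r} = (\<Sum>j\<in>{0}. p j * measure \<mu> (sim_map d m j -` {-r..r}))"
    by simp
  also have "\<dots> \<le> (\<Sum>j\<le>m. p j * measure \<mu> (sim_map d m j -` {-r..r}))"
    by (intro sum_mono2) (use p_pos in \<open>auto intro!: mult_nonneg_nonneg intro: less_imp_le\<close>)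
  also have "\<dots> = measure \<mu> {-r..r}"
    by (rule measure_sim_map[symmetric]) auto
  finally show ?thesis .
qed

text \<open>With s = (d-1)/m and j \<ge> 1, S_j(x) \<le> r gives x \<le> dr - js < 0, so these
  preimages are null and only the term j = 0 survives.\<close>

lemma measure_near_0_eq:
  fixes r :: real
  assumes "real d * r < (real d - 1) / m"
  shows "measure \<mu> {-r..r} = p 0 * measure \<mu> {-(real d * r)..real d * r}"
proof -
  have 0: "sim_map d m 0 -` {-r..r} = {-(real d * r)..real d * r}"
    using d_ge_2 by (auto simp: sim_map_def field_simps)
  have "measure \<mu> {-r..r} = (\<Sum>j\<le>m. p j * measure \<mu> (sim_map d m j -` {-r..r}))"
    by (rule measure_sim_map) auto
  also have "\<dots> = (\<Sum>j\<in>{0}. p j * measure \<mu> (sim_map d m j -` {-r..r}))"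
  proof (intro sum.mono_neutral_right ballI)
    fix j assume j: "j \<in> {..m} - {0}"
    have "sim_map d m j -` {-r..r} \<subseteq> {..<0}"
    proof
      fix x assume "x \<in> sim_map d m j -` {-r..r}"
      then have "sim_map d m j x \<le> r" by auto
      then have "real d * sim_map d m j x \<le> real d * r" by (intro mult_left_mono) auto
      also have "real d * sim_map d m j x = x + real j * ((real d - 1) / m)"
        using d_ge_2 m_pos by (simp add: sim_map_def field_simps)
      finally have "x + real j * ((real d - 1) / m) < (real d - 1) / m" using assms by simp
      moreover have "1 * ((real d - 1) / m) \<le> real j * ((real d - 1) / m)"
        using j d_ge_2 by (intro mult_right_mono) auto
      ultimately show "x \<in> {..<0}" by simp
    qed
    then have "measure \<mu> (sim_map d m j -` {-r..r}) \<le> measure \<mu> {..<0}"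
      by (intro finite_measure_mono) auto
    then show "p j * measure \<mu> (sim_map d m j -` {-r..r}) = 0"
      using measure_negative measure_nonneg[of \<mu> "sim_map d m j -` {-r..r}"] by simp
  qed auto
  finally show ?thesis using 0 by simp
qed

text \<open>Iterating \<open>measure_near_0_ge\<close> costs a factor \<open>p 0\<close> per step
  and magnifies the interval by d, until it covers one of positive mass.\<close>

lemma measure_near_0_pos:
  fixes r :: real
  assumes "r > 0"
  shows "measure \<mu> {-r..r} > 0"
proof -
  obtain R where R: "R > 0" "measure \<mu> {-R..R} > 0" using measure_Icc_pos by blast
  obtain n where n: "real d ^ n > R / r"
    using real_arch_pow[of "real d" "R / r"] d_ge_2 by auto
  have iter: "p 0 ^ n * measure \<mu> {-(real d ^ n * r)..real d ^ n * r} \<le> measure \<mu> {-r..r}" for n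
  proof (induction n)
    case (Suc n)
    have "p 0 ^ Suc n * measure \<mu> {-(real d ^ Suc n * r)..real d ^ Suc n * r} \<le>
        p 0 ^ n * measure \<mu> {-(real d ^ n * r)..real d ^ n * r}"
      using mult_left_mono[OF measure_near_0_ge[of "real d ^ n * r"], of "p 0 ^ n"] p_pos[of 0]
      by (simp add: mult_ac)
    with Suc show ?case by simp
  qed simp
  have "measure \<mu> {-R..R} \<le> measure \<mu> {-(real d ^ n * r)..real d ^ n * r}"
    using n assms by (intro finite_measure_mono) (auto simp: field_simps)
  then have "0 < p 0 ^ n * measure \<mu> {-(real d ^ n * r)..real d ^ n * r}"
    using R p_pos[of 0] by simp
  also note iter
  finally show ?thesis .
qed

text \<open>The exact scaling near 0 makes \<open>\<phi>\<close>, the error of the power law with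
  exponent \<open>\<alpha>\<close>, invariant under r -> dr. It is therefore bounded by its values
  on the fundamental interval [e/d, e), and dividing by ln r sends it to 0.\<close>

lemma has_local_dim_0: "has_local_dim \<mu> 0 (- ln (p 0) / ln d)"
proof -
  define \<alpha> where "\<alpha> = - ln (p 0) / ln d"
  define e where "e = (real d - 1) / m"
  define \<phi> where "\<phi> r = ln (measure \<mu> {-r..r}) - \<alpha> * ln r" for r
  have e: "e > 0" using d_ge_2 m_pos by (simp add: e_def)
  have lnd: "ln (real d) > 0" using d_ge_2 by simp
  have phi_mult: "\<phi> r = \<phi> (real d * r)" if "r > 0" "real d * r < e" for r
  proof -
    have "ln (measure \<mu> {-r..r}) = ln (p 0) + ln (measure \<mu> {-(real d * r)..real d * r})"
      using that d_ge_2 p_pos[of 0] measure_near_0_pos[of "d * r"]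
      by (subst measure_near_0_eq) (auto simp: e_def ln_mult)
    moreover have "\<alpha> * ln (real d * r) = - ln (p 0) + \<alpha> * ln r"
      using that d_ge_2 lnd by (simp add: ln_mult \<alpha>_def field_simps)
    ultimately show ?thesis by (simp add: \<phi>_def)
  qed
  have phi_iter: "r > 0 \<Longrightarrow> real d ^ n * r < e \<Longrightarrow> \<phi> r = \<phi> (real d ^ n * r)" for r n
  proof (induction n)
    case (Suc n)
    have "real d ^ n * r \<le> real d * (real d ^ n * r)"
      using Suc.prems d_ge_2 by auto
    with Suc.prems have "\<phi> r = \<phi> (real d ^ n * r)" by (intro Suc.IH) auto
    also have "\<dots> = \<phi> (real d * (real d ^ n * r))"
      using Suc.prems d_ge_2 by (subst phi_mult) (auto simp: mult_ac)
    finally show ?case by (simp add: mult_ac)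
  qed simp
  \<comment> \<open>On [e/d, e) monotonicity puts ln of the mass between its value at e/d and 0, and
    puts ln r between ln(e/d) and ln e.\<close>
  define B where "B = \<bar>ln (measure \<mu> {-(e / real d)..e / d})\<bar> + \<bar>\<alpha>\<bar> * (\<bar>ln e\<bar> + \<bar>ln (e / real d)\<bar>)"
  have phi_bound_fund: "\<bar>\<phi> r\<bar> \<le> B" if "e / d \<le> r" "r < e" for r
  proof -
    have "e / real d > 0" using e d_ge_2 by simp
    with that(1) have r: "r > 0" by (rule less_le_trans[rotated])
    have "measure \<mu> {-(e / real d)..e / d} \<le> measure \<mu> {-r..r}"
      using that by (intro finite_measure_mono) auto
    then have "ln (measure \<mu> {-(e / real d)..e / d}) \<le> ln (measure \<mu> {-r..r})"
      using measure_near_0_pos[of "e / d"] e d_ge_2 by (subst ln_le_cancel_iff) auto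
    moreover have "ln (measure \<mu> {-r..r}) \<le> 0"
      using measure_near_0_pos[OF r] by auto
    ultimately have "\<bar>ln (measure \<mu> {-r..r})\<bar> \<le> \<bar>ln (measure \<mu> {-(e / real d)..e / d})\<bar>" by simp
    moreover have "ln (e / real d) \<le> ln r" using that r e d_ge_2 by (subst ln_le_cancel_iff) auto
    moreover have "ln r \<le> ln e" using that r e by simp
    ultimately have "\<bar>ln r\<bar> \<le> \<bar>ln e\<bar> + \<bar>ln (e / real d)\<bar>" by linarith
    then have "\<bar>\<alpha> * ln r\<bar> \<le> \<bar>\<alpha>\<bar> * (\<bar>ln e\<bar> + \<bar>ln (e / real d)\<bar>)"
      unfolding abs_mult by (intro mult_left_mono) auto
    then show ?thesis
      using \<open>\<bar>ln (measure \<mu> {-r..r})\<bar> \<le> _\<close> unfolding \<phi>_def B_def by linarith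
  qed
  have phi_bound: "\<bar>\<phi> r\<bar> \<le> B" if "0 < r" "r < e" for r
  proof -
    obtain n0 where "real d ^ n0 > e / r"
      using real_arch_pow[of "real d" "e / r"] d_ge_2 by auto
    then have ex: "\<exists>n. e \<le> real d ^ n * r"
      using that by (intro exI[of _ n0]) (auto simp: field_simps)
    \<comment> \<open>The first power that carries r to at least e. It is not the 0th, as r < e, and
      the power just before it lands in [e/d, e).\<close>
    define n where "n = (LEAST n. e \<le> real d ^ n * r)"
    have n: "e \<le> real d ^ n * r" unfolding n_def using ex by (rule LeastI_ex)
    then have "n \<noteq> 0" using that by (cases n) auto
    then obtain k where k: "n = Suc k" using not0_implies_Suc by blast
    have "\<not> e \<le> real d ^ k * r" using k not_less_Least[of k "\<lambda>n. e \<le> real d ^ n * r"] unfolding n_def by auto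
    moreover have "e / d \<le> real d ^ k * r"
      using n k d_ge_2 by (simp add: field_simps)
    ultimately show ?thesis
      using phi_iter[of r k] phi_bound_fund[of "real d ^ k * r"] that by auto
  qed
  have ln_bot: "filterlim (\<lambda>r. ln r :: real) at_bot (at_right 0)" by (rule ln_at_0)
  have "((\<lambda>r. \<phi> r / ln r) \<longlongrightarrow> 0) (at_right 0)"
  proof (rule tendsto_0_le[where K = 1])
    show "((\<lambda>r. B / ln r) \<longlongrightarrow> 0) (at_right 0)"
      using ln_bot by (intro tendsto_divide_0[OF tendsto_const] filterlim_at_bot_imp_at_infinity)
    have "\<forall>\<^sub>F r in at_right 0. 0 < r \<and> r < e"
      using e by (auto simp: eventually_at_right_field)
    then show "\<forall>\<^sub>F r in at_right 0. norm (\<phi> r / ln r) \<le> norm (B / ln r) * 1"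
    proof eventually_elim
      case (elim r)
      then have "\<bar>\<phi> r\<bar> \<le> \<bar>B\<bar>" using phi_bound[of r] by linarith
      then show ?case by (simp add: divide_right_mono)
    qed
  qed
  then have "((\<lambda>r. \<alpha> + \<phi> r / ln r) \<longlongrightarrow> \<alpha> + 0) (at_right 0)"
    by (intro tendsto_intros)
  moreover have "\<forall>\<^sub>F r in at_right 0.
      \<alpha> + \<phi> r / ln r = ln (measure \<mu> {0 - r..0 + r}) / ln r"
  proof -
    have "\<forall>\<^sub>F r in at_right (0::real). 0 < r \<and> r < 1"
      by (auto simp: eventually_at_right_field intro: exI[of _ 1])
    then show ?thesis
      by eventually_elim (auto simp: \<phi>_def field_simps)
  qed
  ultimately show ?thesis
    unfolding has_local_dim_def \<alpha>_def[symmetric] by (auto dest: Lim_transform_eventually)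
qed

section \<open>Iterated similarities indexed by integers, and the one-step window estimate\<close>

definition level_map :: "nat \<Rightarrow> nat \<Rightarrow> real \<Rightarrow> real" where
  "level_map n k x = (x + real k * ((real d - 1) / real m)) / real d ^ n"

text \<open>Appending a digit j to a word turns its index k into dk + j. Words that give the same
  map share one index, so overlaps are merged from the start.\<close>

lemma level_map_sim_map:
  "level_map n k (sim_map d m j x) = level_map (Suc n) (d * k + j) x"
  using d_ge_2 m_pos by (simp add: level_map_def sim_map_def field_simps)

lemma level_map_vimage_sets: "A \<in> sets borel \<Longrightarrow> level_map n k -` A \<in> sets borel"
proof -
  have "level_map n k \<in> borel_measurable borel" unfolding level_map_def by measurable
  then show "A \<in> sets borel \<Longrightarrow> level_map n k -` A \<in> sets borel"
    using measurable_sets[of "level_map n k" borel borel A] by simp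
qed

lemma measure_level_map:
  assumes "A \<in> sets borel"
  shows "measure \<mu> (level_map n k -` A) =
    (\<Sum>j\<le>m. p j * measure \<mu> (level_map (Suc n) (d * k + j) -` A))"
proof -
  have "sim_map d m j -` (level_map n k -` A) = level_map (Suc n) (d * k + j) -` A" for j
    by (auto simp: level_map_sim_map)
  then show ?thesis
    using measure_sim_map[OF level_map_vimage_sets[OF assms, of n k]] by simp
qed

text \<open>The bound on k describes exactly the indices of words of n digits in {0..m}. The
  constant is the product of the probabilities along one such word, so it does not depend on
  \<open>A\<close>.\<close>

lemma level_map_weight:
  assumes "k \<le> m * (\<Sum>i<n. d ^ i)"
  shows "\<exists>c>0. \<forall>A\<in>sets borel. c * measure \<mu> (level_map n k -` A) \<le> measure \<mu> A"
  using assms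
proof (induction n arbitrary: k)
  case 0
  then have "level_map 0 k -` A = A" for A
    by (simp add: level_map_def vimage_def)
  then show ?case by (intro exI[of _ 1]) auto
next
  case (Suc n)
  define N where "N = m * (\<Sum>i<n. d ^ i)"
  have "m * (\<Sum>i<Suc n. d ^ i) = d * N + m"
    unfolding N_def sum.lessThan_Suc_shift by (simp add: sum_distrib_left algebra_simps)
  with Suc.prems have k: "k \<le> d * N + m" by simp
  \<comment> \<open>Division by d gives a last digit below d, allowed since d - 1 \<le> m. If the
    quotient exceeds the admissible range, the prefix is \<open>N\<close> and the last digit is the
    excess k - dN, which is at most m.\<close>
  obtain k' j where k': "k' \<le> N" "j \<le> m" "k = d * k' + j"
  proof (cases "k div d \<le> N")
    case True
    have "k mod d < d" using d_ge_2 by simp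
    then have "k mod d \<le> m" using m_ge by linarith
    then show ?thesis using True that[of "k div d" "k mod d"] by simp
  next
    case False
    then have "d * N \<le> d * (k div d)" by simp
    also have "\<dots> \<le> k" by simp
    finally show ?thesis using k that[of N "k - d * N"] by simp
  qed
  from Suc.IH[of k'] k' obtain c where c: "c > 0"
    "\<And>A. A \<in> sets borel \<Longrightarrow> c * measure \<mu> (level_map n k' -` A) \<le> measure \<mu> A"
    unfolding N_def by blast
  show ?case
  proof (intro exI[of _ "c * p j"] conjI ballI)
    show "c * p j > 0" using c p_pos k' by simp
    fix A :: "real set" assume A: "A \<in> sets borel"
    have "p j * measure \<mu> (level_map (Suc n) k -` A) =
        (\<Sum>j\<in>{j}. p j * measure \<mu> (level_map (Suc n) (d * k' + j) -` A))"
      using k' by simp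
    also have "\<dots> \<le> (\<Sum>j\<le>m. p j * measure \<mu> (level_map (Suc n) (d * k' + j) -` A))"
      using k' p_pos by (intro sum_mono2) (auto intro!: mult_nonneg_nonneg intro: less_imp_le)
    also have "\<dots> = measure \<mu> (level_map n k' -` A)" by (rule measure_level_map[OF A, symmetric])
    finally have "c * (p j * measure \<mu> (level_map (Suc n) k -` A)) \<le>
        c * measure \<mu> (level_map n k' -` A)"
      using c by (intro mult_left_mono) auto
    also have "\<dots> \<le> measure \<mu> A" using c A by blast
    finally show "c * p j * measure \<mu> (level_map (Suc n) k -` A) \<le> measure \<mu> A"
      by (simp add: mult_ac)
  qed
qed

text \<open>Dual form of the bound on the smallest weight: unit weights on the old window give each
  \<open>k\<close> of the new one the sum of \<open>p j\<close> over its predecessors. All j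
  congruent to k mod d contribute, so this sum is a full residue-class sum and at least the
  minimum.\<close>

lemma window_step:
  fixes g :: "nat \<Rightarrow> real"
  assumes g: "\<And>k. g k \<ge> 0" and K: "K \<ge> m" and K': "d * K \<le> K'" "K' < d * K + d"
  shows "residue_prob_min d m p * (\<Sum>k\<in>{K' - m..K'}. g k) \<le>
    (\<Sum>k\<in>{K - m..K}. \<Sum>j\<le>m. p j * g (d * k + j))"
proof -
  define Res where "Res k = {j. j \<le> m \<and> j mod d = k mod d}" for k
  have fin: "finite (Res k)" for k by (simp add: Res_def)
  have "residue_prob_min d m p * (\<Sum>k\<in>{K' - m..K'}. g k) \<le>
      (\<Sum>k\<in>{K' - m..K'}. (\<Sum>j\<in>Res k. p j) * g k)"
    unfolding sum_distrib_left
    using residue_prob_min_le[of d m p] d_ge_2 g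
    by (intro sum_mono mult_right_mono) (auto simp: residue_prob_def Res_def)
  also have "\<dots> = (\<Sum>(k, j)\<in>Sigma {K' - m..K'} Res. p j * g k)"
    by (simp add: sum_distrib_right sum.Sigma fin)
  also have "\<dots> \<le> (\<Sum>(k, j)\<in>{K - m..K} \<times> {..m}. p j * g (d * k + j))"
  \<comment> \<open>A pair (l, j) of predecessor and digit is sent to its successor dl + j together
    with j. Every pair on the left is hit by one with the same summand, and the remaining summands
    on the right are nonnegative.\<close>
  proof (rule sum_le_included[where i = "\<lambda>(k, j). (d * k + j, j)"])
    show "finite (Sigma {K' - m..K'} Res)" using fin by auto
    show "\<forall>y\<in>{K - m..K} \<times> {..m}. 0 \<le> (case y of (k, j) \<Rightarrow> p j * g (d * k + j))"
      using g p_pos by (auto intro!: mult_nonneg_nonneg intro: less_imp_le)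
    show "\<forall>x\<in>Sigma {K' - m..K'} Res. \<exists>y\<in>{K - m..K} \<times> {..m}.
        (case y of (k, j) \<Rightarrow> (d * k + j, j)) = x \<and>
        (case x of (k, j) \<Rightarrow> p j * g k) \<le> (case y of (k, j) \<Rightarrow> p j * g (d * k + j))"
    proof
      fix x assume "x \<in> Sigma {K' - m..K'} Res"
      then obtain k j where x: "x = (k, j)" "K' - m \<le> k" "k \<le> K'" "j \<le> m" "j mod d = k mod d"
        by (auto simp: Res_def)
      have dm: "2 * m \<le> d * m" using d_ge_2 by simp
      have dK: "d * m \<le> d * K" using K by simp
      \<comment> \<open>Since K \<ge> m, k \<ge> dK - m \<ge> 2m - m \<ge> j, so the natural
        subtraction k - j is a true one.\<close>
      have jk: "j \<le> k" using x dm dK K' by linarith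
      have "d dvd k - j" using x jk mod_eq_dvd_iff_nat[of j k d] by simp
      then obtain l where l: "k - j = d * l" by (auto elim: dvdE)
      have k: "k = d * l + j" using l jk by simp
      have "d * l < d * Suc K" using k x K' by simp
      then have "l \<le> K" by (meson less_Suc_eq_le nat_mult_less_cancel1 mult_less_cancel1)
      \<comment> \<open>Lower edge of the old window: the window width and the digit j each cost at
        most m, and 2m \<le> dm absorbs both.\<close>
      moreover have "d * K \<le> d * l + d * m" using k x(2,4) K'(1) dm by linarith
      then have "d * K \<le> d * (l + m)" by (simp add: algebra_simps)
      then have "K \<le> l + m" using d_ge_2 by simp
      ultimately show "\<exists>y\<in>{K - m..K} \<times> {..m}.
        (case y of (k, j) \<Rightarrow> (d * k + j, j)) = x \<and>
        (case x of (k, j) \<Rightarrow> p j * g k) \<le> (case y of (k, j) \<Rightarrow> p j * g (d * k + j))"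
        using x k by (intro bexI[of _ "(l, j)"]) auto
    qed
  qed auto
  also have "\<dots> = (\<Sum>k\<in>{K - m..K}. \<Sum>j\<le>m. p j * g (d * k + j))"
    by (simp add: sum.cartesian_product)
  finally show ?thesis .
qed

lemma residue_prob_min_pos: "residue_prob_min d m p > 0"
proof (rule less_residue_prob_minI)
  fix i assume i: "i < d"
  then have "i \<le> m" using m_ge by simp
  then show "0 < residue_prob d m p i"
    using residue_prob_geI[of m p i d i] p_pos[of i] by (meson less_le_trans p_pos)
qed (use d_ge_2 in simp)

section \<open>Upper bound for the local dimension at interior points\<close>

lemma measure_interior_ge:
  assumes x: "0 < x" "x < 1"
  shows "\<exists>c>0. \<exists>R>0. \<exists>n0. \<forall>n\<ge>n0.
    c * residue_prob_min d m p ^ n \<le> measure \<mu> {x - R / real d ^ n..x + R / real d ^ n}"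
proof -
  define P where "P = residue_prob_min d m p"
  have P: "P > 0" using residue_prob_min_pos by (simp add: P_def)
  define s where "s = (real d - 1) / m"
  have s: "s > 0" using d_ge_2 m_pos by (simp add: s_def)
  define K where "K n = nat \<lfloor>real d ^ n * x / s\<rfloor>" for n
  have K_le: "K n \<le> real d ^ n * x / s" for n
    unfolding K_def using x s by (simp add: of_nat_nat)
  have K_gt: "real d ^ n * x / s < K n + 1" for n
    unfolding K_def using x s floor_correct[of "real d ^ n * x / s"] by (simp add: of_nat_nat add.commute)
  have K_Suc: "d * K n \<le> K (Suc n)" "K (Suc n) < d * K n + d" for n
  proof -
    have "real (d * K n) \<le> d * (real d ^ n * x / s)"
      unfolding of_nat_mult using K_le[of n] by (intro mult_left_mono) auto
    also have "\<dots> < K (Suc n) + 1" using K_gt[of "Suc n"] by (simp add: mult_ac)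
    finally show "d * K n \<le> K (Suc n)" by linarith
    have "real (K (Suc n)) \<le> d * (real d ^ n * x / s)" using K_le[of "Suc n"] by (simp add: mult_ac)
    also have "\<dots> < real d * (real (K n) + 1)" using K_gt[of n] d_ge_2 by (intro mult_strict_left_mono) auto
    finally have "real (K (Suc n)) < real (d * K n + d)" by (simp add: algebra_simps)
    then show "K (Suc n) < d * K n + d" by linarith
  qed
  have geo: "real (m * (\<Sum>i<n. d ^ i)) = (real d ^ n - 1) / s" for n
  proof -
    have "(\<Sum>i<n. real d ^ i) = (real d ^ n - 1) / (real d - 1)"
      using d_ge_2 by (subst geometric_sum) auto
    then show ?thesis by (simp add: s_def)
  qed
  \<comment> \<open>Here x being interior enters. For large n, x > 0 keeps the window from being cut
    off at index 0, and x < 1 keeps it below the largest admissible index, so every map in the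
    window has a positive weight.\<close>
  obtain n0 where n0: "m \<le> K n0" "K n0 \<le> m * (\<Sum>i<n0. d ^ i)"
  proof -
    define D where "D = max ((real m + 1) * s / x) (1 / (1 - x))"
    obtain n0 where n0: "D < real d ^ n0"
      using real_arch_pow[of "real d" D] d_ge_2 by auto
    have "(real m + 1) * s / x < real d ^ n0" using n0 by (simp add: D_def)
    then have "real m + 1 < real d ^ n0 * x / s" using x s by (simp add: field_simps)
    with K_gt[of n0] have "real m \<le> K n0" by linarith
    moreover have "1 / (1 - x) < real d ^ n0" using n0 by (simp add: D_def)
    then have "real d ^ n0 * x \<le> real d ^ n0 - 1" using x by (simp add: field_simps)
    then have "real d ^ n0 * x / s \<le> (real d ^ n0 - 1) / s"
      using s by (intro divide_right_mono) auto
    then have "real (K n0) \<le> real (m * (\<Sum>i<n0. d ^ i))"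
      using K_le[of n0] unfolding geo by linarith
    ultimately show ?thesis using that[of n0] by linarith
  qed
  have K_ge: "m \<le> K (n0 + n)" for n
  proof (induction n)
    case (Suc n)
    have "1 * K (n0 + n) \<le> d * K (n0 + n)" using d_ge_2 by (intro mult_right_mono) auto
    also note K_Suc(1)[of "n0 + n"]
    finally show ?case using Suc by simp
  qed (use n0 in simp)
  \<comment> \<open>\<open>W\<close> is squeezed: it controls \<open>measure \<mu> A\<close> from
    below at level \<open>n0\<close>, each further level costs at most one factor \<open>P\<close>,
    and at level n it dominates the single term with index \<open>K n\<close>.\<close>
  define W where "W n A = (\<Sum>k\<in>{K n - m..K n}. measure \<mu> (level_map n k -` A))" for n A
  have "\<forall>k\<in>{K n0 - m..K n0}. \<exists>c>0. \<forall>A\<in>sets borel.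
      c * measure \<mu> (level_map n0 k -` A) \<le> measure \<mu> A"
    using n0 by (intro ballI level_map_weight) auto
  from bchoice[OF this] obtain w where w: "\<And>k. k \<in> {K n0 - m..K n0} \<Longrightarrow> w k > 0"
    "\<And>k A. k \<in> {K n0 - m..K n0} \<Longrightarrow> A \<in> sets borel \<Longrightarrow>
        w k * measure \<mu> (level_map n0 k -` A) \<le> measure \<mu> A"
    by blast
  define C where "C = (\<Sum>k\<in>{K n0 - m..K n0}. 1 / w k)"
  have C: "C > 0" unfolding C_def using w(1) by (intro sum_pos) auto
  have W0: "W n0 A \<le> C * measure \<mu> A" if "A \<in> sets borel" for A
    unfolding W_def C_def sum_distrib_right
    using w(1) w(2)[OF _ that] by (intro sum_mono) (simp add: field_simps)
  have W_Suc: "P * W (Suc n) A \<le> W n A" if "A \<in> sets borel" "m \<le> K n" for n A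
  proof -
    have "P * W (Suc n) A \<le>
        (\<Sum>k\<in>{K n - m..K n}. \<Sum>j\<le>m. p j * measure \<mu> (level_map (Suc n) (d * k + j) -` A))"
      unfolding W_def P_def using that K_Suc by (intro window_step) auto
    also have "\<dots> = W n A"
      unfolding W_def by (intro sum.cong refl measure_level_map[OF that(1), symmetric])
    finally show ?thesis .
  qed
  have W_iter: "P ^ n * W (n0 + n) A \<le> W n0 A" if "A \<in> sets borel" for n A
  proof (induction n)
    case (Suc n)
    have "P ^ n * (P * W (Suc (n0 + n)) A) \<le> P ^ n * W (n0 + n) A"
      using P W_Suc[OF that K_ge] by (intro mult_left_mono) auto
    with Suc show ?case by (simp add: mult_ac)
  qed simp
  obtain R where R: "R > 0" "measure \<mu> {-R..R} > 0" using measure_Icc_pos by blast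
  \<comment> \<open>The factor \<open>P ^ n0\<close> in the denominator compensates for starting at
    level \<open>n0\<close>, since only n - n0 window steps are made.\<close>
  define c where "c = measure \<mu> {-R..R} / (C * P ^ n0)"
  have "c * P ^ n \<le> measure \<mu> {x - (R + s) / real d ^ n..x + (R + s) / real d ^ n}" if n: "n \<ge> n0" for n
  proof -
    define A where "A = {x - (R + s) / real d ^ n..x + (R + s) / real d ^ n}"
    have A: "A \<in> sets borel" by (simp add: A_def)
    obtain l where l: "n = n0 + l" using n le_Suc_ex by blast
    have dn: "real d ^ n > 0" using d_ge_2 by simp
    \<comment> \<open>\<open>K n * s\<close> differs from d^n x by at most s, and y by at most R
      from 0. This explains the radius (R + s) / d^n.\<close>
    have "{-R..R} \<subseteq> level_map n (K n) -` A"
    proof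
      fix y assume y: "y \<in> {-R..R}"
      have "K n * s \<le> real d ^ n * x" "real d ^ n * x < K n * s + s"
        using K_le[of n] K_gt[of n] s by (auto simp: field_simps)
      then have "real d ^ n * x - (R + s) \<le> y + K n * s" "y + K n * s \<le> real d ^ n * x + (R + s)"
        using y s by auto
      then have "(real d ^ n * x - (R + s)) / real d ^ n \<le> level_map n (K n) y"
        "level_map n (K n) y \<le> (real d ^ n * x + (R + s)) / real d ^ n"
        unfolding level_map_def s_def[symmetric] using dn by (auto intro!: divide_right_mono)
      then show "y \<in> level_map n (K n) -` A"
        using d_ge_2 by (simp add: A_def diff_divide_distrib add_divide_distrib)
    qed
    then have "measure \<mu> {-R..R} \<le> measure \<mu> (level_map n (K n) -` A)"
      using level_map_vimage_sets[OF A] by (intro finite_measure_mono) auto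
    also have "\<dots> \<le> W n A"
      unfolding W_def by (rule member_le_sum) auto
    finally have "P ^ l * measure \<mu> {-R..R} \<le> P ^ l * W n A"
      using P by (intro mult_left_mono) auto
    also have "\<dots> \<le> C * measure \<mu> A"
      using W_iter[OF A, of l] W0[OF A] l by simp
    finally have "P ^ l * measure \<mu> {-R..R} / C \<le> measure \<mu> A"
      using C by (simp add: field_simps)
    moreover have "c * P ^ n = P ^ l * measure \<mu> {-R..R} / C"
      using P by (simp add: c_def l power_add)
    ultimately show ?thesis by (simp add: A_def)
  qed
  moreover have "c > 0" using R C P by (simp add: c_def)
  moreover have "R + s > 0" using R s by simp
  ultimately show ?thesis unfolding P_def by blast
qed

text \<open>An existing limit can be computed along the radii R / d^n, where the mass is at least c
  P^n.\<close>

lemma local_dim_interior_le: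
  assumes x: "0 < x" "x < 1" and L: "has_local_dim \<mu> x L"
  shows "L \<le> - ln (residue_prob_min d m p) / ln d"
proof -
  define P where "P = residue_prob_min d m p"
  have P: "P > 0" using residue_prob_min_pos by (simp add: P_def)
  obtain c R n0 where c: "c > 0" "R > 0"
    and ge: "\<And>n. n \<ge> n0 \<Longrightarrow> c * P ^ n \<le> measure \<mu> {x - R / real d ^ n..x + R / real d ^ n}"
    using measure_interior_ge[OF x] unfolding P_def by blast
  have lim0: "(\<lambda>n. R / real d ^ n) \<longlonglongrightarrow> 0"
    using d_ge_2 by (intro LIMSEQ_divide_realpow_zero) simp
  have "filterlim (\<lambda>n. R / real d ^ n) (at_right 0) sequentially"
    using lim0 c d_ge_2 by (intro tendsto_imp_filterlim_at_right) auto
  with L have lim: "(\<lambda>n. ln (measure \<mu> {x - R / real d ^ n..x + R / real d ^ n}) / ln (R / real d ^ n)) \<longlonglongrightarrow> L"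
    unfolding has_local_dim_def by (rule filterlim_compose[where g = "\<lambda>r. ln (measure \<mu> {x - r..x + r}) / ln r"])
  have lnd: "ln (real d) > 0" using d_ge_2 by simp
  have "(\<lambda>n. (ln c + real n * ln P) / (ln R - real n * ln d)) \<longlonglongrightarrow> - ln P / ln d"
    using lnd by (rule tendsto_ratio_linear)
  moreover have "\<forall>\<^sub>F n in sequentially.
      ln (measure \<mu> {x - R / real d ^ n..x + R / real d ^ n}) / ln (R / real d ^ n) \<le>
      (ln c + real n * ln P) / (ln R - real n * ln d)"
    using eventually_ge_at_top[of n0] order_tendstoD(2)[OF lim0 zero_less_one]
  proof eventually_elim
    case (elim n)
    have eq1: "ln (R / real d ^ n) = ln R - real n * ln d"
      using c d_ge_2 by (simp add: ln_div ln_realpow)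
    have eq2: "ln (c * P ^ n) = ln c + real n * ln P"
      using c P by (simp add: ln_mult ln_realpow)
    \<comment> \<open>The radius is eventually below 1, so its logarithm is negative and division
      reverses the inequality between the logarithms of the masses.\<close>
    have "ln (R / real d ^ n) \<le> 0" using elim c d_ge_2 by simp
    moreover have "ln (c * P ^ n) \<le> ln (measure \<mu> {x - R / real d ^ n..x + R / real d ^ n})"
      using ge[OF elim(1)] c P by (intro ln_mono) auto
    ultimately show ?case
      unfolding eq1[symmetric] eq2[symmetric] by (intro divide_right_mono_neg)
  qed
  ultimately show ?thesis
    unfolding P_def[symmetric] by (rule tendsto_le[OF sequentially_bot _ lim])
qed

section \<open>Reflection, and the local dimension at 1\<close>

lemma self_similar_reflect:
  "self_similar d m (\<lambda>j. p (m - j)) (distr \<mu> borel (\<lambda>x. 1 - x))"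
proof
  let ?\<mu>' = "distr \<mu> borel (\<lambda>x. 1 - x)"
  have meas: "measure ?\<mu>' A = measure \<mu> ((\<lambda>x. 1 - x) -` A)" if "A \<in> sets borel" for A
    using that by (subst measure_distr) auto
  \<comment> \<open>The reflection x -> 1 - x conjugates S_j to S_{m-j}, which reverses the
    probability vector and exchanges the two endpoints.\<close>
  have reflect: "(\<lambda>x. 1 - x) -` (sim_map d m (m - j) -` A) =
      sim_map d m j -` ((\<lambda>x. 1 - x) -` A)" if "j \<le> m" for j A
  proof -
    have "sim_map d m (m - j) (1 - x) = 1 - sim_map d m j x" for x
      using that d_ge_2 m_pos by (simp add: sim_map_def of_nat_diff field_simps)
    then show ?thesis by auto
  qed
  show "(\<Sum>j\<le>m. p (m - j)) = 1"
    using p_sum sum.reindex_bij_witness[of "{..m}" "\<lambda>j. m - j" "\<lambda>j. m - j" "{..m}" p "\<lambda>j. p (m - j)"]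
    by simp
  show "self_similar_measure d m (\<lambda>j. p (m - j)) ?\<mu>'"
    unfolding self_similar_measure_def
  proof (intro conjI ballI)
    show "prob_space ?\<mu>'" by (rule prob_space_distr) auto
    fix A :: "real set" assume A: "A \<in> sets borel"
    have vA: "(\<lambda>x. 1 - x) -` A \<in> sets borel"
      using measurable_sets[of "\<lambda>x::real. 1 - x" borel borel A] A by simp
    have sA: "sim_map d m j -` A \<in> sets borel" for j
      using measurable_sets[OF sim_map_measurable A, of j] by simp
    have "measure ?\<mu>' A = (\<Sum>j\<le>m. p j * measure \<mu> (sim_map d m j -` ((\<lambda>x. 1 - x) -` A)))"
      unfolding meas[OF A] by (rule measure_sim_map[OF vA])
    also have "\<dots> = (\<Sum>j\<le>m. p j * measure ?\<mu>' (sim_map d m (m - j) -` A))"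
      using meas[OF sA] by (intro sum.cong) (auto simp: reflect)
    also have "\<dots> = (\<Sum>j\<le>m. p (m - j) * measure ?\<mu>' (sim_map d m j -` A))"
      by (rule sum.reindex_bij_witness[of _ "\<lambda>j. m - j" "\<lambda>j. m - j"]) auto
    finally show "measure ?\<mu>' A = (\<Sum>j\<le>m. p (m - j) * measure ?\<mu>' (sim_map d m j -` A))" .
  qed simp
qed (use d_ge_2 m_ge p_pos in auto)

lemma has_local_dim_1: "has_local_dim \<mu> 1 (- ln (p m) / ln d)"
proof -
  interpret R: self_similar d m "\<lambda>j. p (m - j)" "distr \<mu> borel (\<lambda>x. 1 - x)"
    by (rule self_similar_reflect)
  have "(\<lambda>x. 1 - x) -` {0 - r..0 + r} = {1 - r..1 + r}" for r :: real
    by auto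
  then have "measure (distr \<mu> borel (\<lambda>x. 1 - x)) {0 - r..0 + r} = measure \<mu> {1 - r..1 + r}" for r
    by (subst measure_distr) auto
  then show ?thesis using R.has_local_dim_0 by (simp add: has_local_dim_def)
qed

section \<open>Isolation of the endpoint dimensions\<close>

lemma local_dim_isolated_atI:
  assumes x: "x = 0 \<or> x = 1" and L: "has_local_dim \<mu> x L"
    and gt: "L > - ln (residue_prob_min d m p) / ln d"
  shows "local_dim_isolated_at \<mu> x"
proof -
  define M where "M = - ln (residue_prob_min d m p) / ln d"
  have sub: "local_dims \<mu> \<subseteq> {..M} \<union> {local_dim \<mu> 0, local_dim \<mu> 1}"
  proof
    fix l assume "l \<in> local_dims \<mu>"
    then obtain y where y: "y \<in> {0..1}" "local_dim_exists \<mu> y" "l = local_dim \<mu> y"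
      by (auto simp: local_dims_def)
    show "l \<in> {..M} \<union> {local_dim \<mu> 0, local_dim \<mu> 1}"
    proof (cases "y = 0 \<or> y = 1")
      case False
      from y(2) obtain L' where "has_local_dim \<mu> y L'" by (auto simp: local_dim_exists_def)
      with y False show ?thesis
        using local_dim_interior_le[of y L'] by (auto simp: local_dim_eq M_def)
    qed (use y in auto)
  qed
  have L_eq: "local_dim \<mu> x = L" using L by (rule local_dim_eq)
  have mem: "L \<in> local_dims \<mu>"
    unfolding local_dims_def local_dim_exists_def using x L L_eq by fastforce
  \<comment> \<open>Besides values at most \<open>M\<close> there are only the two endpoint
    dimensions. The other endpoint is removed from the neighbourhood only if its value differs from
    \<open>L\<close>, since the two may coincide.\<close>
  define T where "T = {M<..} - ({local_dim \<mu> 0, local_dim \<mu> 1} - {L})"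
  have "open T" unfolding T_def by (intro open_Diff finite_imp_closed) auto
  moreover have "T \<inter> local_dims \<mu> = {L}"
    using sub mem gt by (auto simp: T_def M_def)
  ultimately show ?thesis
    using L L_eq mem unfolding local_dim_isolated_at_def local_dim_exists_def isolated_in_def
    by auto
qed

lemma isolated_at_0:
  assumes "p 0 < residue_prob_min d m p"
  shows "local_dim_isolated_at \<mu> 0"
  by (rule local_dim_isolated_atI[OF _ has_local_dim_0])
    (use assms p_pos[of 0] d_ge_2 in \<open>auto intro!: divide_strict_right_mono\<close>)

lemma isolated_at_1:
  assumes "p m < residue_prob_min d m p"
  shows "local_dim_isolated_at \<mu> 1"
  by (rule local_dim_isolated_atI[OF _ has_local_dim_1])
    (use assms p_pos[of m] d_ge_2 in \<open>auto intro!: divide_strict_right_mono\<close>)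

end

theorem corollary5p7:
  fixes d m :: nat and p :: "nat \<Rightarrow> real" and \<mu> :: "real measure"
  assumes "d \<ge> 2" and "m \<ge> d - 1"
    and "\<And>j. j \<le> m \<Longrightarrow> p j > 0"
    and "(\<Sum>j\<le>m. p j) = 1"
    and "self_similar_measure d m p \<mu>"
  shows "(p 0 < residue_prob_min d m p \<longrightarrow> local_dim_isolated_at \<mu> 0) \<and>
         (m \<ge> d \<and> (\<forall>j\<le>m. j \<noteq> 0 \<and> j \<noteq> m \<longrightarrow> p 0 < p j) \<longrightarrow> local_dim_isolated_at \<mu> 0) \<and>
         (p m < residue_prob_min d m p \<longrightarrow> local_dim_isolated_at \<mu> 1) \<and>
         (m \<ge> d \<and> (\<forall>j\<le>m. j \<noteq> 0 \<and> j \<noteq> m \<longrightarrow> p m < p j) \<longrightarrow> local_dim_isolated_at \<mu> 1)"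
proof -
  interpret self_similar d m p \<mu> by unfold_locales (use assms in auto)
  show ?thesis
  proof (intro conjI impI; (elim conjE)?)
    assume "d \<le> m" and less: "\<forall>j\<le>m. j \<noteq> 0 \<and> j \<noteq> m \<longrightarrow> p 0 < p j"
    show "local_dim_isolated_at \<mu> 0"
      by (intro isolated_at_0 first_less_residue_prob_min) (use d_ge_2 \<open>d \<le> m\<close> p_pos less in blast)+
  next
    assume "d \<le> m" and less: "\<forall>j\<le>m. j \<noteq> 0 \<and> j \<noteq> m \<longrightarrow> p m < p j"
    show "local_dim_isolated_at \<mu> 1"
      by (intro isolated_at_1 last_less_residue_prob_min) (use d_ge_2 \<open>d \<le> m\<close> p_pos less in blast)+
  qed (rule isolated_at_0 isolated_at_1, assumption)+
qed

end
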